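(* ${\rm cov}(\mathcal N)\le\mathfrak a(\mathcal N_T)$ and $\mathfrak a\le\mathfrak a(\mathcal N_T)$.
   Context: $T={}^{\omega>}2$ ordered by $b'\le_T b$ iff $b\subseteq b'$; for $f\in{}^\omega2$, $B(f)=\{f\restriction n:n\in\omega\}$; for $X\subseteq T$, $\lfloor X\rfloor=\{f\in{}^\omega2:|B(f)\cap X|=\aleph_0\}$. Let $\sigma$ be the standard product (fair coin) measure on ${}^\omega 2$ and $\mu(X)=\sigma(\lfloor X\rfloor)$. $\mathcal N_T=\{X\in[T]^{\aleph_0}:\mu(X)=0\}$. Ad = almost disjoint (finite intersection). For $\mathcal X\subseteq[S]^{\aleph_0}$ with $S=\bigcup\mathcal X$, $\mathcal F\subseteq\mathcal X$ is mad in $\mathcal X$ if it is pairwise ad and no $X\in\mathcal X$ is ad to all members of $\mathcal F$; $\mathfrak a(\mathcal X)=\min\{|\mathcal F|:|\mathcal F|\ge\aleph_0,\ \mathcal F\text{ mad in }\mathcal X\}$. $\mathfrak a$ is the almost disjointness number and ${\rm cov}(\mathcal N)$ the covering number of the null ideal. *)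

theory Defs
  imports "HOL-Probability.Probability"
begin

unbundle cardinal_syntax

text \<open>
  Cardinals are represented by cardinal orders and compared with \<open>\<le>o\<close>, which also relates
  cardinals of sets over different types. The minimum is attained whenever the family is
  nonempty, and it is then unique up to \<open>=o\<close>.
\<close>

definition min_card :: "'a set set \<Rightarrow> 'a rel" where
  "min_card \<A> = (SOME r. \<exists>A\<in>\<A>. r = |A| \<and> (\<forall>B\<in>\<A>. |A| \<le>o |B| ))"

lemma min_card_attained:
  assumes "\<A> \<noteq> {}"
  shows "\<exists>A\<in>\<A>. min_card \<A> = |A| \<and> (\<forall>B\<in>\<A>. |A| \<le>o |B| )"
proof -
  have "\<exists>r\<in>card_of ` \<A>. \<forall>r'\<in>card_of ` \<A>. r \<le>o r'"
    by (rule exists_minim_Well_order) (use assms in \<open>auto simp: card_of_Well_order\<close>)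
  then have "\<exists>r. \<exists>A\<in>\<A>. r = |A| \<and> (\<forall>B\<in>\<A>. |A| \<le>o |B| )"
    by auto
  then show ?thesis
    unfolding min_card_def by (rule someI_ex)
qed

definition aleph0_subsets :: "'a set \<Rightarrow> 'a set set" where
  "aleph0_subsets S = {X. X \<subseteq> S \<and> |X| =o natLeq}"

definition almost_disjoint :: "'a set \<Rightarrow> 'a set \<Rightarrow> bool" where
  "almost_disjoint A B \<longleftrightarrow> finite (A \<inter> B)"

definition mad_in :: "'a set set \<Rightarrow> 'a set set \<Rightarrow> bool" where
  "mad_in \<X> \<F> \<longleftrightarrow> \<F> \<subseteq> \<X> \<and> pairwise almost_disjoint \<F> \<and>
     \<not> (\<exists>X\<in>\<X>. \<forall>F\<in>\<F>. almost_disjoint X F)"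

definition ad_number_in :: "'a set set \<Rightarrow> 'a set rel" where
  "ad_number_in \<X> = min_card {\<F>. natLeq \<le>o |\<F>| \<and> mad_in \<X> \<F>}"

definition ad_number :: "nat set rel" where
  "ad_number = ad_number_in (aleph0_subsets (UNIV :: nat set))"

definition coin_measure :: "(nat \<Rightarrow> bool) measure" where
  "coin_measure = (\<Pi>\<^sub>M i\<in>UNIV. measure_pmf (bernoulli_pmf (1/2)))"

text \<open>
  The null ideal contains all subsets of measurable sets of measure zero, hence the completion.
\<close>

definition null_ideal :: "(nat \<Rightarrow> bool) set set" where
  "null_ideal = null_sets (completion coin_measure)"

definition cov_null :: "(nat \<Rightarrow> bool) set rel" where
  "cov_null = min_card {\<C>. \<C> \<subseteq> null_ideal \<and> \<Union>\<C> = UNIV}"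

text \<open>The nodes of the binary tree are the finite 0-1 sequences, that is, all Boolean lists.\<close>

definition branch :: "(nat \<Rightarrow> bool) \<Rightarrow> bool list set" where
  "branch f = range (\<lambda>n. map f [0..<n])"

definition branches_through :: "bool list set \<Rightarrow> (nat \<Rightarrow> bool) set" where
  "branches_through X = {f. |branch f \<inter> X| =o natLeq}"

definition tree_measure :: "bool list set \<Rightarrow> ennreal" where
  "tree_measure X = emeasure coin_measure (branches_through X)"

definition null_T :: "bool list set set" where
  "null_T = {X \<in> aleph0_subsets UNIV. tree_measure X = 0}"

text \<open>
  Since \<^const>\<open>emeasure\<close> is zero outside the sigma-algebra, \<^const>\<open>tree_measure\<close> is meaningful
  only because the sets it is applied to are measurable.
\<close>

lemma branches_through_iff:
  "f \<in> branches_through X \<longleftrightarrow> (\<forall>m. \<exists>n\<ge>m. map f [0..<n] \<in> X)"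
proof -
  let ?g = "\<lambda>n. map f [0..<n]"
  have inj: "inj ?g"
    by (rule injI) (metis diff_zero length_map length_upt)
  have eq: "branch f \<inter> X = ?g ` {n. ?g n \<in> X}"
    by (auto simp: branch_def)
  have "|branch f \<inter> X| =o natLeq \<longleftrightarrow> infinite (branch f \<inter> X)"
  proof
    assume "|branch f \<inter> X| =o natLeq"
    then show "infinite (branch f \<inter> X)"
      using infinite_iff_natLeq_ordLeq ordIso_iff_ordLeq by blast
  next
    assume "infinite (branch f \<inter> X)"
    then have "natLeq \<le>o |branch f \<inter> X|"
      using infinite_iff_natLeq_ordLeq by blast
    moreover have "|branch f \<inter> X| \<le>o |UNIV :: nat set|"
      by (meson card_of_ordLeqI countableE countableI_type UNIV_I)
    then have "|branch f \<inter> X| \<le>o natLeq"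
      using card_of_nat ordLeq_ordIso_trans by blast
    ultimately show "|branch f \<inter> X| =o natLeq"
      using ordIso_iff_ordLeq by blast
  qed
  also have "\<dots> \<longleftrightarrow> infinite {n. ?g n \<in> X}"
    unfolding eq using inj by (simp add: finite_image_iff inj_on_subset)
  also have "\<dots> \<longleftrightarrow> (\<forall>m. \<exists>n\<ge>m. ?g n \<in> X)"
    by (auto simp: infinite_nat_iff_unbounded_le)
  finally show ?thesis
    by (simp add: branches_through_def)
qed

lemma branches_through_measurable: "branches_through X \<in> sets coin_measure"
proof -
  have sp: "space coin_measure = UNIV"
    by (simp add: coin_measure_def space_PiM)
  have coord: "{f. f i = b} \<in> sets coin_measure" for i b
  proof -
    have "(\<lambda>f. f i) \<in> measurable coin_measure (measure_pmf (bernoulli_pmf (1/2)))"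
      unfolding coin_measure_def by (rule measurable_component_singleton) simp
    from measurable_sets[OF this, of "{b}"] show ?thesis
      by (simp add: sp vimage_def)
  qed
  have node: "{f. map f [0..<n] = s} \<in> sets coin_measure" for n s
  proof (cases "length s = n")
    case True
    then have "{f. map f [0..<n] = s} = {f \<in> space coin_measure. \<forall>i\<in>{..<n}. f i = s ! i}"
      by (auto simp: list_eq_iff_nth_eq sp)
    also have "\<dots> \<in> sets coin_measure"
      by (rule sets.sets_Collect_finite_All) (auto simp: coord sp)
    finally show ?thesis .
  next
    case False
    then have "{f. map f [0..<n] = s} = {}"
      by auto
    then show ?thesis by simp
  qed
  have "branches_through X = (\<Inter>m. \<Union>n\<in>{m..}. \<Union>s\<in>X. {f. map f [0..<n] = s})"
    by (simp add: set_eq_iff branches_through_iff Bex_def)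
  also have "\<dots> \<in> sets coin_measure"
  proof (rule sets.countable_INT'')
    show "UNIV \<in> sets coin_measure"
      using sets.top[of coin_measure] by (simp add: sp)
    show "(\<Union>n\<in>{m..}. \<Union>s\<in>X. {f. map f [0..<n] = s}) \<in> sets coin_measure" for m
      by (intro sets.countable_UN'' node; simp)
  qed simp
  finally show ?thesis .
qed

end

theory Submission
  imports Defs
begin

text \<open>
  Every branch of the tree is a null set of nodes, so it meets some member of a family that is mad
  among the null sets in an infinite set: the null sets \<open>\<lfloor>X\<rfloor>\<close>, for \<open>X\<close> in the family, cover the
  Cantor space.

  For the second inequality, pick countably many members of the mad family and a sequence of nodes
  that hits each of them infinitely often and whose \<open>k\<close>-th node has length at least \<open>k\<close>. By
  Borel--Cantelli every set of nodes of the sequence is null, so pulling the family back along the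
  sequence gives an infinite mad family of subsets of \<open>\<nat>\<close>.
\<close>

section \<open>Cardinals of families and of countable sets\<close>

lemma min_card_lower:
  assumes "A \<in> \<A>"
  shows "min_card \<A> \<le>o |A|"
proof -
  from assms have "\<A> \<noteq> {}"
    by blast
  from min_card_attained[OF this] obtain M where "min_card \<A> = |M|" "\<forall>B\<in>\<A>. |M| \<le>o |B|"
    by (elim bexE conjE)
  with assms show ?thesis
    by simp
qed

lemma aleph0_subsets_iff_infinite:
  fixes S :: "'a::countable set"
  shows "X \<in> aleph0_subsets S \<longleftrightarrow> X \<subseteq> S \<and> infinite X"
proof -
  have "|X| \<le>o natLeq"
    by (meson card_of_nat card_of_ordLeqI countableE countableI_type UNIV_I ordLeq_ordIso_trans)
  then have "|X| =o natLeq \<longleftrightarrow> infinite X"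
    using infinite_iff_natLeq_ordLeq ordIso_iff_ordLeq by blast
  then show ?thesis
    by (simp add: aleph0_subsets_def)
qed

section \<open>Cylinders and null sets of nodes\<close>

definition cylinder :: "bool list \<Rightarrow> (nat \<Rightarrow> bool) set" where
  "cylinder s = {f. map f [0..<length s] = s}"

text \<open>This is the form in which the product measure provides both measurability and the
  product formula for the measure of a box.\<close>

lemma cylinder_eq_prod_emb:
  "cylinder s = prod_emb UNIV (\<lambda>_. measure_pmf (bernoulli_pmf (1/2))) {..<length s}
     (\<Pi>\<^sub>E i\<in>{..<length s}. {s ! i})"
proof (rule set_eqI)
  fix f
  have "f \<in> cylinder s \<longleftrightarrow> (\<forall>i<length s. f i = s ! i)"
    unfolding cylinder_def mem_Collect_eq list_eq_iff_nth_eq by simp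
  then show "f \<in> cylinder s \<longleftrightarrow>
      f \<in> prod_emb UNIV (\<lambda>_. measure_pmf (bernoulli_pmf (1/2))) {..<length s}
        (\<Pi>\<^sub>E i\<in>{..<length s}. {s ! i})"
    unfolding prod_emb_iff restrict_PiE_iff extensional_UNIV by (simp add: Ball_def)
qed

lemma cylinder_measurable: "cylinder s \<in> sets coin_measure"
  unfolding cylinder_eq_prod_emb coin_measure_def by (rule sets_PiM_I) auto

lemma emeasure_cylinder: "emeasure coin_measure (cylinder s) = ennreal ((1/2) ^ length s)"
proof -
  interpret product_prob_space "\<lambda>_::nat. measure_pmf (bernoulli_pmf (1/2))" UNIV
    by standard
  have "emeasure coin_measure (cylinder s) =
      (\<Prod>i\<in>{..<length s}. emeasure (measure_pmf (bernoulli_pmf (1/2))) {s ! i})"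
    unfolding cylinder_eq_prod_emb coin_measure_def by (rule emeasure_PiM_emb) auto
  also have "\<dots> = (\<Prod>i\<in>{..<length s}. ennreal (1/2))"
  proof (rule prod.cong)
    fix i
    show "emeasure (measure_pmf (bernoulli_pmf (1/2))) {s ! i} = ennreal (1/2)"
      by (cases "s ! i") (simp_all add: emeasure_pmf_single)
  qed simp
  also have "\<dots> = ennreal ((1/2) ^ length s)"
    unfolding prod_constant by (subst ennreal_power) simp_all
  finally show ?thesis .
qed

lemma branches_through_mono: "X \<subseteq> Y \<Longrightarrow> branches_through X \<subseteq> branches_through Y"
  by (intro subsetI, unfold branches_through_iff) (meson subsetD)

lemma null_T_iff: "X \<in> null_T \<longleftrightarrow> infinite X \<and> branches_through X \<in> null_sets coin_measure"
  by (auto simp: null_T_def aleph0_subsets_iff_infinite tree_measure_def null_sets_def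
      branches_through_measurable)

text \<open>The cylinder of \<open>s k\<close> has measure at most \<open>(1/2)^k\<close>, which is
  summable, so almost every \<open>f\<close> lies in only finitely many of these cylinders.
  Repetitions in \<open>s\<close> do no harm.\<close>

lemma tree_null_range:
  fixes s :: "nat \<Rightarrow> bool list"
  assumes len: "\<And>k. k \<le> length (s k)"
  shows "branches_through (range s) \<in> null_sets coin_measure"
proof -
  have m: "measure coin_measure (cylinder t) = (1/2) ^ length t" for t
    by (simp add: measure_def emeasure_cylinder)
  have "limsup (\<lambda>k. cylinder (s k)) \<in> null_sets coin_measure"
  proof (rule borel_cantelli_limsup1)
    show "summable (\<lambda>k. measure coin_measure (cylinder (s k)))"
      unfolding m
      by (rule summable_comparison_test'[of "\<lambda>k. (1/2::real) ^ k" 0])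
        (auto intro: power_decreasing len)
  qed (simp_all add: cylinder_measurable emeasure_cylinder)
  moreover have "branches_through (range s) \<subseteq> limsup (\<lambda>k. cylinder (s k))"
  proof
    fix f assume f: "f \<in> branches_through (range s)"
    have "\<exists>k\<ge>m. f \<in> cylinder (s k)" for m
    proof -
      \<comment> \<open>Only the first \<open>m\<close> terms of \<open>s\<close> have to be
        avoided: a node on \<open>f\<close> that is at least as long as the bound \<open>b\<close>
        must have an index \<open>k\<close> with \<open>k \<ge> m\<close>.\<close>
      obtain b where b: "\<And>j. j < m \<Longrightarrow> length (s j) < b"
        using finite_nat_set_iff_bounded[of "(\<lambda>j. length (s j)) ` {..<m}"] by auto
      obtain n k where "n \<ge> b" and nk: "map f [0..<n] = s k"
        using f unfolding branches_through_iff by (metis rangeE)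
      from nk have "length (s k) = n"
        by (metis length_map length_upt diff_zero)
      with b[of k] \<open>n \<ge> b\<close> nk show ?thesis
        by (intro exI[of _ k]) (auto simp: cylinder_def not_less[symmetric])
    qed
    then show "f \<in> limsup (\<lambda>k. cylinder (s k))"
      by (auto simp: limsup_INF_SUP)
  qed
  ultimately show ?thesis
    using null_sets_subset branches_through_measurable by blast
qed

section \<open>Branches and an infinite mad family\<close>

lemma inj_initial_segments: "inj (\<lambda>n. map f [0..<n])"
  by (rule injI) (metis diff_zero length_map length_upt)

lemma branch_null_T: "branch f \<in> null_T"
proof -
  have "infinite (branch f)"
    unfolding branch_def using inj_initial_segments by (rule range_inj_infinite)
  moreover have "branches_through (branch f) \<in> null_sets coin_measure"
    unfolding branch_def by (rule tree_null_range) simp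
  ultimately show ?thesis
    by (simp add: null_T_iff)
qed

text \<open>Two sequences that differ at \<open>i\<close> share no initial segment of length greater
  than \<open>i\<close>.\<close>

lemma branches_almost_disjoint:
  assumes "f \<noteq> g"
  shows "almost_disjoint (branch f) (branch g)"
proof -
  from assms obtain i where i: "f i \<noteq> g i"
    by auto
  have "branch f \<inter> branch g \<subseteq> (\<lambda>n. map f [0..<n]) ` {..i}"
  proof
    fix t assume "t \<in> branch f \<inter> branch g"
    then obtain n m where n: "t = map f [0..<n]" and m: "t = map g [0..<m]"
      unfolding branch_def by blast
    then have "n = m"
      by (metis length_map length_upt diff_zero)
    with n m i have "n \<le> i"
      by (auto simp: not_less[symmetric])
    with n show "t \<in> (\<lambda>n. map f [0..<n]) ` {..i}"
      by auto
  qed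
  then show ?thesis
    unfolding almost_disjoint_def by (rule finite_subset) simp
qed

text \<open>Zorn's lemma yields a maximal almost disjoint family above the given one.\<close>

lemma mad_in_extend:
  assumes sub: "\<F> \<subseteq> \<X>" and ad: "pairwise almost_disjoint \<F>"
    and inf: "\<And>X. X \<in> \<X> \<Longrightarrow> infinite X"
  obtains \<G> where "\<F> \<subseteq> \<G>" and "mad_in \<X> \<G>"
proof -
  define P where "P = {\<G>. \<F> \<subseteq> \<G> \<and> \<G> \<subseteq> \<X> \<and> pairwise almost_disjoint \<G>}"
  have "\<exists>M\<in>P. \<forall>\<G>\<in>P. M \<subseteq> \<G> \<longrightarrow> \<G> = M"
  proof (rule subset_Zorn_nonempty)
    show "P \<noteq> {}"
      using sub ad by (auto simp: P_def)
  next
    fix \<C> assume ne: "\<C> \<noteq> {}" and "subset.chain P \<C>"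
    then have "\<C> \<subseteq> P" and tot: "\<And>A B. A \<in> \<C> \<Longrightarrow> B \<in> \<C> \<Longrightarrow> A \<subseteq> B \<or> B \<subseteq> A"
      by (auto simp: subset_chain_def)
    moreover have "pairwise almost_disjoint (\<Union>\<C>)"
    proof (rule pairwiseI)
      fix X Y assume "X \<in> \<Union>\<C>" "Y \<in> \<Union>\<C>" "X \<noteq> Y"
      then obtain A where "A \<in> \<C>" "X \<in> A" "Y \<in> A"
        using tot by blast
      with \<open>\<C> \<subseteq> P\<close> \<open>X \<noteq> Y\<close> show "almost_disjoint X Y"
        unfolding P_def by (blast dest: pairwiseD)
    qed
    ultimately show "\<Union>\<C> \<in> P"
      using ne by (auto simp: P_def)
  qed
  then obtain M where M: "M \<in> P" and max: "\<And>\<G>. \<G> \<in> P \<Longrightarrow> M \<subseteq> \<G> \<Longrightarrow> \<G> = M"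
    by blast
  have "False" if X: "X \<in> \<X>" and ad_X: "\<forall>F\<in>M. almost_disjoint X F" for X
  proof -
    have "insert X M \<in> P"
      using M X ad_X by (auto simp: P_def pairwise_insert almost_disjoint_def Int_commute)
    \<comment> \<open>Now \<open>X\<close> would be almost disjoint from itself, that is,
      finite.\<close>
    then have "X \<in> M"
      using max by blast
    with ad_X inf[OF X] show False
      by (auto simp: almost_disjoint_def)
  qed
  with M show thesis
    by (intro that[of M]) (unfold P_def mad_in_def, blast+)
qed

text \<open>This makes \<open>ad_number_in null_T\<close> a genuine minimum rather than an arbitrary
  choice over an empty collection. The branches form an infinite almost disjoint family to start
  from.\<close>

lemma infinite_mad_null_T_exists: "\<exists>\<F>. natLeq \<le>o |\<F>| \<and> mad_in null_T \<F>"
proof -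
  have "inj branch"
  proof (rule injI, rule ccontr)
    fix f g assume "branch f = branch g" "f \<noteq> g"
    then show False
      using branches_almost_disjoint[of f g] branch_null_T[of g]
      by (simp add: almost_disjoint_def null_T_iff)
  qed
  moreover have "infinite (UNIV :: (nat \<Rightarrow> bool) set)"
    by (simp add: finite_UNIV_fun)
  ultimately have inf: "infinite (range branch)"
    by (simp add: finite_image_iff)
  have "pairwise almost_disjoint (range branch)"
    by (rule pairwise_imageI) (rule branches_almost_disjoint)
  then obtain \<G> where "range branch \<subseteq> \<G>" "mad_in null_T \<G>"
    by (rule mad_in_extend[of "range branch" null_T, rotated])
      (use branch_null_T in \<open>auto simp: null_T_iff\<close>)
  with inf show ?thesis
    using infinite_iff_natLeq_ordLeq infinite_super by blast
qed

section \<open>The two inequalities\<close>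

lemma cov_null_le_mad_null_T:
  assumes mad: "mad_in null_T \<F>"
  shows "cov_null \<le>o |\<F>|"
proof -
  let ?C = "branches_through ` \<F>"
  have "?C \<subseteq> null_ideal"
    using mad by (auto simp: null_ideal_def mad_in_def null_T_iff intro!: null_sets_completionI)
  moreover have "f \<in> \<Union>?C" for f
  proof -
    obtain X where "X \<in> \<F>" "infinite (branch f \<inter> X)"
      using mad branch_null_T[of f] by (auto simp: mad_in_def almost_disjoint_def)
    then show ?thesis
      using aleph0_subsets_iff_infinite[of "branch f \<inter> X" UNIV]
      by (auto simp: branches_through_def aleph0_subsets_def)
  qed
  ultimately have "cov_null \<le>o |?C|"
    unfolding cov_null_def by (intro min_card_lower) auto
  then show ?thesis
    using card_of_image ordLeq_transitive by blast
qed

lemma ad_number_le_mad_null_T: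
  assumes inf: "natLeq \<le>o |\<F>|" and mad: "mad_in null_T \<F>"
  shows "ad_number \<le>o |\<F>|"
proof -
  from inf have "infinite \<F>"
    using infinite_iff_natLeq_ordLeq by blast
  then obtain A :: "nat \<Rightarrow> bool list set" where "inj A" and A: "range A \<subseteq> \<F>"
    using infinite_countable_subset by blast
  have inf_\<F>: "infinite X" if "X \<in> \<F>" for X
    using that mad by (auto simp: mad_in_def null_T_iff)
  have ad_\<F>: "finite (X \<inter> Y)" if "X \<in> \<F>" "Y \<in> \<F>" "X \<noteq> Y" for X Y
    using that mad by (auto simp: mad_in_def almost_disjoint_def pairwise_def)
  have long: "\<exists>t\<in>X. k \<le> length t" if "X \<in> \<F>" for X k
  proof (rule ccontr)
    assume "\<not> ?thesis"
    then have "X \<subseteq> {t. set t \<subseteq> UNIV \<and> length t \<le> k}"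
      by auto
    then show False
      using inf_\<F>[OF that] finite_lists_length_le[of "UNIV :: bool set" k] finite_subset by auto
  qed
  \<comment> \<open>The first component of \<open>prod_decode k\<close> takes every value
    \<open>n\<close> infinitely often, so each \<open>A n\<close> is visited at infinitely many
    indices.\<close>
  have "\<exists>t. t \<in> A (fst (prod_decode k)) \<and> k \<le> length t" for k
    using long[of "A (fst (prod_decode k))" k] A by auto
  then obtain s where s: "\<And>k. s k \<in> A (fst (prod_decode k))" and len: "\<And>k. k \<le> length (s k)"
    by metis
  \<comment> \<open>Since \<open>k \<le> length (s k)\<close>, each node has only finitely many
    indices: \<open>s\<close> is finite-to-one, and pulling back along it preserves almost
    disjointness.\<close>
  have fin_vimage: "finite (s -` Y)" if "finite Y" for Y
  proof -
    have "s -` Y \<subseteq> (\<Union>t\<in>Y. {..length t})"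
      using len by auto
    then show ?thesis
      using that finite_subset by blast
  qed
  \<comment> \<open>Members of \<open>\<F>\<close> that \<open>s\<close> meets at only finitely many
    indices are dropped, since their preimages are not infinite sets.\<close>
  define \<H> where "\<H> = (\<lambda>X. s -` X) ` {X \<in> \<F>. infinite (s -` X)}"
  have "mad_in (aleph0_subsets UNIV) \<H>"
    unfolding mad_in_def
  proof (intro conjI notI)
    show "\<H> \<subseteq> aleph0_subsets UNIV"
      by (auto simp: \<H>_def aleph0_subsets_iff_infinite)
    show "pairwise almost_disjoint \<H>"
    proof (rule pairwiseI)
      fix U V assume "U \<in> \<H>" "V \<in> \<H>" "U \<noteq> V"
      then obtain X Y where "X \<in> \<F>" "Y \<in> \<F>" "X \<noteq> Y" and UV: "U = s -` X" "V = s -` Y"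
        by (auto simp: \<H>_def)
      then have "finite (s -` (X \<inter> Y))"
        by (intro fin_vimage ad_\<F>)
      then show "almost_disjoint U V"
        by (simp add: UV almost_disjoint_def)
    qed
  next
    assume "\<exists>Z\<in>aleph0_subsets UNIV. \<forall>H\<in>\<H>. almost_disjoint Z H"
    then obtain Z where "infinite Z" and Z: "\<And>H. H \<in> \<H> \<Longrightarrow> finite (Z \<inter> H)"
      by (auto simp: aleph0_subsets_iff_infinite almost_disjoint_def)
    have "infinite (s ` Z)"
      using fin_vimage[of "s ` Z"] \<open>infinite Z\<close> finite_subset[of Z "s -` s ` Z"] by blast
    moreover have "branches_through (s ` Z) \<in> null_sets coin_measure"
      using tree_null_range[of s] len branches_through_mono[of "s ` Z" "range s"]
        branches_through_measurable null_sets_subset by blast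
    ultimately have "s ` Z \<in> null_T"
      by (simp add: null_T_iff)
    then obtain X where X: "X \<in> \<F>" "infinite (s ` Z \<inter> X)"
      using mad by (auto simp: mad_in_def almost_disjoint_def)
    have "s ` Z \<inter> X = s ` (Z \<inter> s -` X)"
      by auto
    with X have "infinite (Z \<inter> s -` X)"
      by auto
    with X Z[of "s -` X"] show False
      by (auto simp: \<H>_def)
  qed
  moreover have "infinite \<H>"
  proof -
    have inf_A: "infinite (s -` A n)" for n
    proof -
      have "range (\<lambda>m. prod_encode (n, m)) \<subseteq> s -` A n"
        using s by (auto) (metis fst_conv prod_encode_inverse)
      moreover have "infinite (range (\<lambda>m. prod_encode (n, m)))"
        by (rule range_inj_infinite) (auto simp: inj_def)
      ultimately show ?thesis
        using finite_subset by blast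
    qed
    \<comment> \<open>If two of these preimages were equal, this infinite set would be the preimage
      of the finite set \<open>A n \<inter> A m\<close>.\<close>
    have "inj (\<lambda>n. s -` A n)"
    proof (rule injI, rule ccontr)
      fix n m assume eq: "s -` A n = s -` A m" and "n \<noteq> m"
      then have "finite (s -` (A n \<inter> A m))"
        using A \<open>inj A\<close> by (intro fin_vimage ad_\<F>) (auto dest: injD)
      with eq inf_A[of m] show False
        by simp
    qed
    then have "infinite (range (\<lambda>n. s -` A n))"
      by (rule range_inj_infinite)
    moreover have "range (\<lambda>n. s -` A n) \<subseteq> \<H>"
      using A inf_A by (auto simp: \<H>_def)
    ultimately show ?thesis
      using finite_subset by blast
  qed
  ultimately have "ad_number \<le>o |\<H>|"
    unfolding ad_number_def ad_number_in_def
    by (intro min_card_lower) (use infinite_iff_natLeq_ordLeq in blast)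
  also have "|\<H>| \<le>o |{X \<in> \<F>. infinite (s -` X)}|"
    unfolding \<H>_def by (rule card_of_image)
  also have "|{X \<in> \<F>. infinite (s -` X)}| \<le>o |\<F>|"
    by (rule card_of_mono1) auto
  finally show ?thesis .
qed

theorem theorem2p10:
  shows "cov_null \<le>o ad_number_in null_T \<and> ad_number \<le>o ad_number_in null_T"
proof -
  let ?M = "{\<F>. natLeq \<le>o |\<F>| \<and> mad_in null_T \<F>}"
  have "?M \<noteq> {}"
    using infinite_mad_null_T_exists by simp
  from min_card_attained[OF this] obtain \<F> where "\<F> \<in> ?M" and eq: "min_card ?M = |\<F>|"
    by (elim bexE conjE)
  then have "natLeq \<le>o |\<F>|" "mad_in null_T \<F>"
    by simp_all
  then show ?thesis
    unfolding ad_number_in_def[of null_T] eq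
    by (intro conjI cov_null_le_mad_null_T ad_number_le_mad_null_T)
qed

end
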